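(* Let $\mathcal{M}=\{\mathcal{M}_1,\mathcal{M}_2,\ldots\}$ be one of the model classes described in the context ($\mathcal{M}_k=\mathcal{T}_k$ for all $k$, or $\mathcal{M}_k=\mathfrak{G}_k$ for all $k$). Let $\mathbf{A}\in\{0,1\}^{m\times N}$ be the adjacency matrix of a model-expander of left degree $d$ whose expansion coefficient of order $3k$ satisfies $\epsilon_{\mathcal{M}_{3k}}<1/12$. Then there are constants $\alpha<1$ and $\beta>0$, depending only on $\epsilon_{\mathcal{M}_{3k}}$, such that for every $\mathcal{M}_k$-sparse set $\mathcal{S}\subseteq[N]$, every $\mathbf{x}\in\mathbb{R}^N$ and every $\mathbf{e}\in\mathbb{R}^m$, the sequence of updates $(\mathbf{x}^n)$ of MEIHT (for the model $\mathcal{M}_k$) with input $\mathbf{y}=\mathbf{A}\mathbf{x}+\mathbf{e}$ satisfies, for every $n\ge 0$, $$\|\mathbf{x}^n-\mathbf{x}_{\mathcal{S}}\|_1\le \alpha^n\|\mathbf{x}^0-\mathbf{x}_{\mathcal{S}}\|_1+(1-\alpha^n)\,\beta\,\|\mathbf{A}\mathbf{x}_{\bar{\mathcal{S}}}+\mathbf{e}\|_1 .$$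
   Context: Notation: $[N]=\{1,\ldots,N\}$; for $\mathcal{S}\subseteq[N]$, $\bar{\mathcal{S}}=[N]\setminus\mathcal{S}$, and $\mathbf{x}_{\mathcal{S}}\in\mathbb{R}^N$ agrees with $\mathbf{x}$ on $\mathcal{S}$ and is $0$ elsewhere. Models. (a) Tree model: fix an integer $D\ge2$ and a $D$-ary rooted tree $\mathcal{T}$ whose nodes are the elements of $[N]$. A $k$-rooted connected subtree is a set $\mathcal{K}$ of at most $k$ nodes such that all ancestors of every element of $\mathcal{K}$ are in $\mathcal{K}$ (so the root is in $\mathcal{K}$). $\mathcal{T}_k$ is the collection of all $k$-rooted connected subtrees. (b) Group model: fix a group structure $\mathfrak{G}=\{\mathcal{G}_1,\ldots,\mathcal{G}_M\}$, i.e. subsets $\mathcal{G}_j\subseteq[N]$ (which may overlap) with $\bigcup_j\mathcal{G}_j=[N]$. $\mathfrak{G}_k$ is the collection of all sets that are a union of at most $k$ of the groups. In either case, a set $\mathcal{S}\subseteq[N]$ is $\mathcal{M}_k$-sparse if $\mathcal{S}\subseteq\mathcal{K}$ for some $\mathcal{K}\in\mathcal{M}_k$, and a vector is $\mathcal{M}_k$-sparse if its support is. Model-expanders. Let $G=([N],[m],\mathcal{E})$ be a bipartite graph with left nodes $[N]$, right nodes $[m]$, in which every left node has degree $d$; $\Gamma(\mathcal{S})\subseteq[m]$ is the set of neighbours of $\mathcal{S}\subseteq[N]$, and $\Gamma(i)=\Gamma(\{i\})$. Its adjacency matrix $\mathbf{A}\in\{0,1\}^{m\times N}$ has $A_{ji}=1$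 iff $j\in\Gamma(i)$. $G$ is a $(k,d,\epsilon)$-model expander if $|\Gamma(\mathcal{S})|\ge(1-\epsilon)d|\mathcal{S}|$ for every $\mathcal{M}_k$-sparse set $\mathcal{S}$. The expansion coefficient $\epsilon_{\mathcal{M}_k}$ of order $k$ is the smallest $\epsilon$ for which this holds. MEIHT. The median operator $\mathrm{Med}:\mathbb{R}^m\to\mathbb{R}^N$ is $[\mathrm{Med}(\mathbf{u})]_i=\mathrm{median}[u_j: j\in\Gamma(i)]$, where the median of $d$ numbers is the $\lceil d/2\rceil$-th largest one. $\mathcal{P}_{\mathcal{M}_k}(\mathbf{b})$ is any minimizer of $\|\mathbf{b}-\mathbf{z}\|_1$ over all $\mathcal{M}_k$-sparse vectors $\mathbf{z}\in\mathbb{R}^N$. Given $\mathbf{A}$ and $\mathbf{y}\in\mathbb{R}^m$, MEIHT sets $\mathbf{x}^0=\mathbf{0}$ and iterates $\mathbf{x}^{n+1}=\mathcal{P}_{\mathcal{M}_k}\left[\mathbf{x}^n+\mathrm{Med}(\mathbf{y}-\mathbf{A}\mathbf{x}^n)\right]$. *)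

theory Defs
  imports Complex_Main "HOL-Library.Multiset" "Jordan_Normal_Form.Matrix"
begin

text \<open>The index set \<open>[N]\<close> is rendered as \<open>{..<N}\<close>, matching the zero-based indices of
  \<open>Jordan_Normal_Form.Matrix\<close>. A model \<open>\<M>\<^sub>k\<close> is a set of subsets of \<open>{..<N}\<close> and a model class is
  a map \<open>k \<mapsto> \<M>\<^sub>k\<close>.\<close>

text \<open>Edges of a rooted tree are (parent, child) pairs.\<close>

definition dary_rooted_tree :: "nat \<Rightarrow> nat set \<Rightarrow> nat \<Rightarrow> (nat \<times> nat) set \<Rightarrow> bool" where
  "dary_rooted_tree D V r T \<longleftrightarrow>
     r \<in> V \<and> T \<subseteq> V \<times> V \<and>
     (\<forall>u. (u, r) \<notin> T) \<and>
     (\<forall>v\<in>V - {r}. \<exists>!u. (u, v) \<in> T) \<and>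
     (\<forall>v\<in>V. (r, v) \<in> T\<^sup>*) \<and>
     (\<forall>v\<in>V. card (T `` {v}) \<le> D)"

text \<open>The proper ancestors of \<open>v\<close> are the \<open>u\<close> with \<open>(u, v) \<in> T\<^sup>+\<close>. Nonemptiness
  makes the root belong to every rooted connected subtree.\<close>

definition rooted_subtrees :: "nat set \<Rightarrow> (nat \<times> nat) set \<Rightarrow> nat \<Rightarrow> nat set set" where
  "rooted_subtrees V T k =
     {K. K \<subseteq> V \<and> K \<noteq> {} \<and> card K \<le> k \<and> (\<forall>v\<in>K. \<forall>u. (u, v) \<in> T\<^sup>+ \<longrightarrow> u \<in> K)}"

definition group_unions :: "nat set set \<Rightarrow> nat \<Rightarrow> nat set set" where
  "group_unions \<GG> k = {\<Union>\<C> | \<C>. \<C> \<subseteq> \<GG> \<and> card \<C> \<le> k}"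

definition is_tree_model :: "nat \<Rightarrow> (nat \<Rightarrow> nat set set) \<Rightarrow> bool" where
  "is_tree_model N \<M> \<longleftrightarrow>
     (\<exists>D r T. D \<ge> 2 \<and> dary_rooted_tree D {..<N} r T \<and> \<M> = rooted_subtrees {..<N} T)"

definition is_group_model :: "nat \<Rightarrow> (nat \<Rightarrow> nat set set) \<Rightarrow> bool" where
  "is_group_model N \<M> \<longleftrightarrow> (\<exists>\<GG>. \<Union>\<GG> = {..<N} \<and> \<M> = group_unions \<GG>)"

definition model_sparse_set :: "nat set set \<Rightarrow> nat set \<Rightarrow> bool" where
  "model_sparse_set Mk S \<longleftrightarrow> (\<exists>K\<in>Mk. S \<subseteq> K)"

definition supp_vec :: "real vec \<Rightarrow> nat set" where
  "supp_vec x = {i. i < dim_vec x \<and> x $ i \<noteq> 0}"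

definition model_sparse_vec :: "nat set set \<Rightarrow> real vec \<Rightarrow> bool" where
  "model_sparse_vec Mk x \<longleftrightarrow> model_sparse_set Mk (supp_vec x)"

definition left_regular_bipartite :: "nat \<Rightarrow> nat \<Rightarrow> nat \<Rightarrow> (nat \<times> nat) set \<Rightarrow> bool" where
  "left_regular_bipartite N m d E \<longleftrightarrow>
     E \<subseteq> {..<N} \<times> {..<m} \<and> (\<forall>i<N. card (E `` {i}) = d)"

definition adjacency_mat :: "nat \<Rightarrow> nat \<Rightarrow> (nat \<times> nat) set \<Rightarrow> real mat" where
  "adjacency_mat N m E = mat m N (\<lambda>(j, i). if j \<in> E `` {i} then 1 else 0)"

definition model_expander :: "nat \<Rightarrow> (nat \<times> nat) set \<Rightarrow> nat set set \<Rightarrow> real \<Rightarrow> bool" where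
  "model_expander d E Mk \<epsilon> \<longleftrightarrow>
     (\<forall>S. model_sparse_set Mk S \<longrightarrow> real (card (E `` S)) \<ge> (1 - \<epsilon>) * real d * real (card S))"

text \<open>The minimum exists whenever \<open>d > 0\<close> and there are finitely many \<open>Mk\<close>-sparse sets, all
  finite and not all empty.\<close>

definition expansion_coeff :: "nat \<Rightarrow> (nat \<times> nat) set \<Rightarrow> nat set set \<Rightarrow> real" where
  "expansion_coeff d E Mk = (LEAST \<epsilon>. model_expander d E Mk \<epsilon>)"

definition l1_norm :: "real vec \<Rightarrow> real" where
  "l1_norm x = (\<Sum>i<dim_vec x. \<bar>x $ i\<bar>)"

definition restrict_vec :: "real vec \<Rightarrow> nat set \<Rightarrow> real vec" where
  "restrict_vec x S = vec (dim_vec x) (\<lambda>i. if i \<in> S then x $ i else 0)"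

definition median :: "real multiset \<Rightarrow> real" where
  "median M = rev (sorted_list_of_multiset M) ! (nat \<lceil>real (size M) / 2\<rceil> - 1)"

definition Med :: "nat \<Rightarrow> (nat \<times> nat) set \<Rightarrow> real vec \<Rightarrow> real vec" where
  "Med N E u = vec N (\<lambda>i. median (image_mset (\<lambda>j. u $ j) (mset_set (E `` {i}))))"

definition is_model_projection :: "nat \<Rightarrow> nat set set \<Rightarrow> real vec \<Rightarrow> real vec \<Rightarrow> bool" where
  "is_model_projection N Mk b z \<longleftrightarrow>
     is_arg_min (\<lambda>z. l1_norm (b - z)) (\<lambda>z. z \<in> carrier_vec N \<and> model_sparse_vec Mk z) z"

text \<open>The projection need not be unique; every choice of minimizer at every step is allowed.\<close>

definition MEIHT_sequence ::
  "nat \<Rightarrow> nat \<Rightarrow> (nat \<times> nat) set \<Rightarrow> nat set set \<Rightarrow> real vec \<Rightarrow> (nat \<Rightarrow> real vec) \<Rightarrow> bool" where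
  "MEIHT_sequence N m E Mk y xs \<longleftrightarrow>
     xs 0 = 0\<^sub>v N \<and>
     (\<forall>n. is_model_projection N Mk
            (xs n + Med N E (y - adjacency_mat N m E *\<^sub>v xs n)) (xs (Suc n)))"

end

theory Submission
  imports Defs
begin

text \<open>
  One iteration contracts the error \<open>x\<^sub>S - x\<^sup>n\<close> by the factor \<open>\<alpha> = 8 \<epsilon> / (1 - 4 \<epsilon>)\<close>, up to a multiple
  of the noise; \<open>\<alpha> < 1\<close> is the condition \<open>\<epsilon> < 1/12\<close>. The residual \<open>y - A x\<^sup>n\<close> is a noisy measurement
  \<open>A h + g\<close> of the error \<open>h = x\<^sub>S - x\<^sup>n\<close>, with noise \<open>g\<close> equal to the measurement of \<open>x\<close> outside
  \<open>S\<close> plus \<open>e\<close>, so the point is that medians nearly invert \<open>A\<close> on sparse vectors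
  (\<open>median_error_bound\<close>). For this, let \<open>T\<close> contain the support of \<open>h\<close>, all of whose subsets expand.
  Expansion yields an index \<open>i \<in> T\<close> such that at least \<open>(1 - 2 \<epsilon>) d\<close> of its neighbours have no other
  neighbour in \<open>T\<close> (\<open>exists_mostly_private\<close>). At such a private neighbour \<open>j\<close> the measurement is
  \<open>h\<^sub>i + g\<^sub>j\<close>. Half of all \<open>d\<close> measurements around \<open>i\<close> are at least as far from \<open>h\<^sub>i\<close> as the median
  (\<open>half_deviates_from_median\<close>), and \<open>(1/2 - 2 \<epsilon>) d\<close> of these are private, so the error of the median
  at \<open>i\<close> is paid for by the noise at private neighbours alone. The index \<open>i\<close> is then deleted
  from \<open>T\<close>: the \<open>2 \<epsilon> d\<close> or fewer shared neighbours see \<open>h\<^sub>i\<close> as additional noise, and the private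
  ones disappear, so that no noise entry is charged twice. Induction on \<open>T\<close> adds up these costs.

  The projection costs a factor of two by the triangle inequality, restricted to the union \<open>T\<close> of
  \<open>S\<close> and the supports of two consecutive iterates (\<open>best_approximation_on_support\<close>). All three sets
  are sparse of order \<open>k\<close>, and in both kinds of model the orders add under unions, which is where the
  order \<open>3 k\<close> of the expansion coefficient comes from. Iterating the resulting affine recursion gives
  \<open>\<beta> = 4 / (1 - 4 \<epsilon>) / (1 - \<alpha>) = 4 / (1 - 12 \<epsilon>)\<close>; the noise term of a step carries a further
  factor \<open>1/d\<close>, which is bounded by one to make \<open>\<beta>\<close> a function of \<open>\<epsilon>\<close>.
\<close>

section \<open>Order statistics\<close>

text \<open>This is the only property of the median that the convergence proof needs. If the median lies
  above \<open>c\<close>, all larger entries are farther from \<open>c\<close>, and if it lies below, all smaller ones are; the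
  \<open>\<lceil>d/2\<rceil>\<close>-th largest of \<open>d\<close> entries has, counting itself, at least \<open>d/2\<close> entries on either side.\<close>

lemma half_deviates_from_median:
  fixes f :: "'a \<Rightarrow> real"
  assumes fin: "finite J" and ne: "J \<noteq> {}"
  shows "card J \<le> 2 * card {j \<in> J. \<bar>median (image_mset f (mset_set J)) - c\<bar> \<le> \<bar>f j - c\<bar>}"
proof -
  define d where "d = card J"
  define ys where "ys = sorted_list_of_multiset (image_mset f (mset_set J))"
  define p where "p = nat \<lceil>real d / 2\<rceil> - 1"
  define v where "v = median (image_mset f (mset_set J))"
  have d0: "d > 0"
    using fin ne by (simp add: d_def card_gt_0_iff)
  have srt: "sorted ys" by (simp add: ys_def)
  have ms: "mset ys = image_mset f (mset_set J)" by (simp add: ys_def)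
  have len: "length ys = d"
    using ms by (metis d_def size_image_mset size_mset size_mset_set)
  have p1: "d \<le> 2 * (p + 1)" "2 * p < d"
  proof -
    have "d \<le> 2 * nat \<lceil>real d / 2\<rceil>" "2 * nat \<lceil>real d / 2\<rceil> < d + 2" "nat \<lceil>real d / 2\<rceil> > 0"
      using d0 by (linarith, linarith, simp)
    then show "d \<le> 2 * (p + 1)" and "2 * p < d" by (auto simp: p_def)
  qed
  have v: "v = ys ! (d - 1 - p)"
    using p1 len d0
    unfolding v_def median_def ys_def[symmetric] size_image_mset size_mset_set d_def[symmetric] p_def[symmetric]
    by (simp add: rev_nth)
  have count: "card {j \<in> J. P (f j)} = card {q. q < d \<and> P (ys ! q)}" for P
  proof -
    have "card {j \<in> J. P (f j)} = size (filter_mset P (image_mset f (mset_set J)))"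
      using fin by (simp add: filter_mset_image_mset filter_mset_mset_set)
    also have "\<dots> = length (filter P ys)"
      by (metis ms mset_filter size_mset)
    also have "\<dots> = card {q. q < d \<and> P (ys ! q)}"
      by (simp add: length_filter_conv_card len)
    finally show ?thesis .
  qed
  show ?thesis
  proof (cases "c \<le> v")
    case True
    have "{d - 1 - p..<d} \<subseteq> {q. q < d \<and> v \<le> ys ! q}"
      using srt len v by (auto intro: sorted_nth_mono)
    then have "card {d - 1 - p..<d} \<le> card {j \<in> J. v \<le> f j}"
      unfolding count[of "\<lambda>t. v \<le> t"] by (intro card_mono) auto
    also have "\<dots> \<le> card {j \<in> J. \<bar>v - c\<bar> \<le> \<bar>f j - c\<bar>}"
      using True fin by (intro card_mono) auto
    finally show ?thesis
      using p1 d0 unfolding v_def[symmetric] d_def[symmetric] by simp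
  next
    case False
    have "{0..<d - p} \<subseteq> {q. q < d \<and> ys ! q \<le> v}"
    proof
      fix q assume "q \<in> {0..<d - p}"
      then have "q \<le> d - 1 - p" "d - 1 - p < length ys" "q < d" using len d0 by auto
      then show "q \<in> {q. q < d \<and> ys ! q \<le> v}"
        using sorted_nth_mono[OF srt] v by auto
    qed
    then have "card {0..<d - p} \<le> card {j \<in> J. f j \<le> v}"
      unfolding count[of "\<lambda>t. t \<le> v"] by (intro card_mono) auto
    also have "\<dots> \<le> card {j \<in> J. \<bar>v - c\<bar> \<le> \<bar>f j - c\<bar>}"
      using False fin by (intro card_mono) auto
    finally show ?thesis
      using p1 d0 unfolding v_def[symmetric] d_def[symmetric] by simp
  qed
qed

section \<open>Private neighbours in an expander\<close>

text \<open>Count, for each neighbour \<open>j\<close> of \<open>S\<close>, its edges into \<open>S\<close> plus one if there is only one such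
  edge: the count is at least two in either case. Summing over \<open>j\<close> and regrouping by \<open>i \<in> S\<close> gives the
  inequality.\<close>

lemma private_neighbours_total:
  fixes E :: "('a \<times> 'b) set"
  assumes fin: "finite S" and fE: "finite (E `` S)"
  shows "2 * card (E `` S)
    \<le> (\<Sum>i\<in>S. card (E `` {i})) + (\<Sum>i\<in>S. card (E `` {i} - E `` (S - {i})))"
proof -
  define \<Gamma> where "\<Gamma> = E `` S"
  have f: "finite \<Gamma>" using fE by (simp add: \<Gamma>_def)
  have flip: "(\<Sum>i\<in>S. card (B i)) = (\<Sum>j\<in>\<Gamma>. card {i \<in> S. j \<in> B i})"
    if "\<And>i. i \<in> S \<Longrightarrow> B i \<subseteq> \<Gamma>" for B :: "'a \<Rightarrow> 'b set"
  proof -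
    have "(\<Sum>i\<in>S. card (B i)) = (\<Sum>i\<in>S. card {j \<in> \<Gamma>. j \<in> B i})"
      using that by (intro sum.cong arg_cong[where f = card]) auto
    also have "\<dots> = (\<Sum>j\<in>\<Gamma>. card {i \<in> S. j \<in> B i})"
      by (rule sum_multicount_gen[OF fin f]) simp
    finally show ?thesis .
  qed
  have pos: "2 \<le> card {i \<in> S. j \<in> E `` {i}} + card {i \<in> S. j \<in> E `` {i} - E `` (S - {i})}"
    if j: "j \<in> \<Gamma>" for j
  proof -
    obtain i where i: "i \<in> S" "(i, j) \<in> E" using j by (auto simp: \<Gamma>_def)
    show ?thesis
    proof (cases "j \<in> E `` (S - {i})")
      case True
      then obtain l where "l \<in> S" "l \<noteq> i" "(l, j) \<in> E" by auto
      then have "card {i, l} \<le> card {i \<in> S. j \<in> E `` {i}}"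
        using i fin by (intro card_mono) auto
      then show ?thesis using \<open>l \<noteq> i\<close> by auto
    next
      case False
      have "card {i} \<le> card {i \<in> S. j \<in> E `` {i}}"
        using i fin by (intro card_mono) auto
      moreover have "card {i} \<le> card {i \<in> S. j \<in> E `` {i} - E `` (S - {i})}"
        using i fin False by (intro card_mono) auto
      ultimately show ?thesis by simp
    qed
  qed
  have "2 * card \<Gamma> = (\<Sum>j\<in>\<Gamma>. 2)" by simp
  also have "\<dots> \<le> (\<Sum>j\<in>\<Gamma>. card {i \<in> S. j \<in> E `` {i}}
      + card {i \<in> S. j \<in> E `` {i} - E `` (S - {i})})"
    by (rule sum_mono) (use pos in auto)
  also have "\<dots> = (\<Sum>i\<in>S. card (E `` {i})) + (\<Sum>i\<in>S. card (E `` {i} - E `` (S - {i})))"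
    unfolding sum.distrib
    by (subst (1 2) flip) (auto simp: \<Gamma>_def)
  finally show ?thesis by (simp add: \<Gamma>_def)
qed

text \<open>With \<open>d |S|\<close> edges and at least \<open>(1 - \<theta>) d |S|\<close> neighbours, the previous count leaves
  \<open>(1 - 2 \<theta>) d\<close> private neighbours per element of \<open>S\<close> on average.\<close>

lemma exists_mostly_private:
  fixes E :: "('a \<times> 'b) set"
  assumes fin: "finite S" and ne: "S \<noteq> {}" and fE: "finite (E `` S)"
    and deg: "\<And>i. i \<in> S \<Longrightarrow> card (E `` {i}) = d"
    and exp: "(1 - \<theta>) * real d * real (card S) \<le> real (card (E `` S))"
  shows "\<exists>i\<in>S. (1 - 2 * \<theta>) * real d \<le> real (card (E `` {i} - E `` (S - {i})))"
proof (rule ccontr)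
  assume "\<not> ?thesis"
  then have "real (card (E `` {i} - E `` (S - {i}))) < (1 - 2 * \<theta>) * real d" if "i \<in> S" for i
    using that by (simp add: not_le)
  then have "(\<Sum>i\<in>S. real (card (E `` {i} - E `` (S - {i})))) < (\<Sum>i\<in>S. (1 - 2 * \<theta>) * real d)"
    using fin ne by (intro sum_strict_mono) auto
  moreover have "real (2 * card (E `` S))
      \<le> real ((\<Sum>i\<in>S. card (E `` {i})) + (\<Sum>i\<in>S. card (E `` {i} - E `` (S - {i}))))"
    using private_neighbours_total[OF fin fE] of_nat_le_iff by blast
  moreover have "(\<Sum>i\<in>S. card (E `` {i})) = card S * d"
    using deg by simp
  ultimately show False
    using exp by (simp add: algebra_simps)
qed

section \<open>Recovery by medians\<close>

text \<open>The noise \<open>e\<close> is kept general because the induction on \<open>S\<close> changes it: deleting an index \<open>i\<close> from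
  \<open>S\<close> turns the column of \<open>i\<close>, scaled by \<open>x i\<close>, into noise. Only the noise on the neighbours of \<open>S\<close>
  appears in the bound, since the induction has to charge the private neighbours of \<open>i\<close> to \<open>i\<close> and the
  remaining ones to the rest of \<open>S\<close>.\<close>

lemma median_error_bound:
  fixes x e :: "nat \<Rightarrow> real" and E :: "(nat \<times> nat) set"
  assumes fin: "finite S" and fE: "finite (E `` S)" and d: "d > 0"
    and \<theta>: "\<theta> < 1 / 4"
    and deg: "\<And>i. i \<in> S \<Longrightarrow> card (E `` {i}) = d"
    and exp: "\<And>S'. S' \<subseteq> S \<Longrightarrow> (1 - \<theta>) * real d * real (card S') \<le> real (card (E `` S'))"
  shows "(\<Sum>i\<in>S. \<bar>median (image_mset (\<lambda>j. (\<Sum>l\<in>S. if (l, j) \<in> E then x l else 0) + e j)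
                       (mset_set (E `` {i}))) - x i\<bar>)
    \<le> 4 * \<theta> / (1 - 4 * \<theta>) * (\<Sum>i\<in>S. \<bar>x i\<bar>)
      + 2 / ((1 - 4 * \<theta>) * real d) * (\<Sum>j\<in>E `` S. \<bar>e j\<bar>)"
  using fin fE deg exp
proof (induction "card S" arbitrary: S e)
  case 0
  then show ?case by simp
next
  case (Suc n)
  note fin = Suc.prems(1) and fE = Suc.prems(2) and deg = Suc.prems(3) and exp = Suc.prems(4)
  define err where "err = (\<lambda>S (e :: nat \<Rightarrow> real) i.
    \<bar>median (image_mset (\<lambda>j. (\<Sum>l\<in>S. if (l, j) \<in> E then x l else 0) + e j)
                       (mset_set (E `` {i}))) - x i\<bar>)"
  have ne: "S \<noteq> {}" using Suc.hyps(2) by auto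
  obtain i where iS: "i \<in> S"
    and priv: "(1 - 2 * \<theta>) * real d \<le> real (card (E `` {i} - E `` (S - {i})))"
    using exists_mostly_private[OF fin ne fE deg exp[OF subset_refl]] by blast
  define S' where "S' = S - {i}"
  define U where "U = E `` {i} - E `` S'"
  define C where "C = 2 / ((1 - 4 * \<theta>) * real d)"
  have C0: "C > 0" using \<theta> d by (simp add: C_def)
  have S_eq: "S = insert i S'" "i \<notin> S'" "finite S'" "S' \<subseteq> S" using iS fin by (auto simp: S'_def)
  have fi: "finite (E `` {i})" and fS': "finite (E `` S')" and fU: "finite U"
    using fE iS S_eq by (auto simp: U_def elim!: finite_subset[rotated])
  have \<Gamma>_eq: "E `` S = U \<union> E `` S'" "U \<inter> E `` S' = {}"
    using S_eq by (auto simp: U_def)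
  have cU: "(1 - 2 * \<theta>) * real d \<le> real (card U)"
    using priv by (simp add: U_def S'_def)
  have clash: "real (card (E `` {i} \<inter> E `` S')) \<le> 2 * \<theta> * real d"
  proof -
    have "card (E `` {i}) = card (E `` {i} \<inter> E `` S') + card U"
      unfolding U_def by (rule card_Int_Diff[OF fi])
    then have "real (card (E `` {i} \<inter> E `` S')) + real (card U) = real d"
      using deg[OF iS] by simp
    then show ?thesis using cU by (simp add: algebra_simps)
  qed

  \<comment> \<open>The median at \<open>i\<close> is bounded by the noise on the private neighbours \<open>U\<close>: of the \<open>d / 2\<close>
    deviating neighbours in \<open>H\<close>, at most \<open>2 \<theta> d\<close> are shared with other indices.\<close>
  have removed: "err S e i \<le> C * (\<Sum>j\<in>U. \<bar>e j\<bar>)"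
  proof -
    define f where "f = (\<lambda>j. (\<Sum>l\<in>S. if (l, j) \<in> E then x l else 0) + e j)"
    define H where "H = {j \<in> E `` {i}. err S e i \<le> \<bar>f j - x i\<bar>}"
    have "E `` {i} \<noteq> {}" using deg[OF iS] d by auto
    then have "d \<le> 2 * card H"
      using half_deviates_from_median[OF fi, of f "x i"] deg[OF iS]
      by (simp add: H_def err_def f_def)
    moreover have "card H = card (H \<inter> E `` S') + card (H - E `` S')"
      by (intro card_Int_Diff finite_subset[OF _ fi]) (auto simp: H_def)
    moreover have "card (H \<inter> E `` S') \<le> card (E `` {i} \<inter> E `` S')"
      using fi by (intro card_mono) (auto simp: H_def)
    ultimately have "real d / 2 - 2 * \<theta> * real d \<le> real (card (H - E `` S'))"
      using clash by linarith
    then have "(1 - 4 * \<theta>) * real d / 2 * err S e i \<le> real (card (H - E `` S')) * err S e i"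
      by (intro mult_right_mono) (simp_all add: err_def algebra_simps)
    also have "\<dots> \<le> (\<Sum>j\<in>H - E `` S'. \<bar>e j\<bar>)"
    proof -
      have "err S e i \<le> \<bar>e j\<bar>" if j: "j \<in> H - E `` S'" for j
      proof -
        have "(\<Sum>l\<in>S'. if (l, j) \<in> E then x l else 0) = 0"
          using j by (intro sum.neutral) auto
        then have "f j = x i + e j"
          using j S_eq by (simp add: f_def H_def)
        then show ?thesis using j by (simp add: H_def)
      qed
      then show ?thesis
        using sum_bounded_below[of "H - E `` S'" "err S e i" "\<lambda>j. \<bar>e j\<bar>"] by simp
    qed
    also have "\<dots> \<le> (\<Sum>j\<in>U. \<bar>e j\<bar>)"
      using fU by (intro sum_mono2) (auto simp: U_def H_def)
    finally show ?thesis
      using \<theta> d by (simp add: C_def field_simps)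
  qed

  \<comment> \<open>For the other indices nothing changes if the contribution of \<open>i\<close> is counted as noise, and on
    the neighbours of \<open>S'\<close> this adds \<open>\<bar>x i\<bar>\<close> at most \<open>2 \<theta> d\<close> times.\<close>
  define e' where "e' = (\<lambda>j. e j + (if (i, j) \<in> E then x i else 0))"
  have rest: "err S e l = err S' e' l" for l
    using S_eq by (simp add: err_def e'_def add_ac)
  have "(\<Sum>j\<in>E `` S'. \<bar>e' j\<bar>) \<le> (\<Sum>j\<in>E `` S'. \<bar>e j\<bar> + (if (i, j) \<in> E then \<bar>x i\<bar> else 0))"
    by (rule sum_mono) (auto simp: e'_def)
  also have "\<dots> = (\<Sum>j\<in>E `` S'. \<bar>e j\<bar>) + real (card (E `` {i} \<inter> E `` S')) * \<bar>x i\<bar>"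
  proof -
    have "(\<Sum>j\<in>E `` S'. if (i, j) \<in> E then \<bar>x i\<bar> else 0) = (\<Sum>j\<in>{j \<in> E `` S'. (i, j) \<in> E}. \<bar>x i\<bar>)"
      by (rule sum.inter_filter[OF fS', symmetric])
    also have "{j \<in> E `` S'. (i, j) \<in> E} = E `` {i} \<inter> E `` S'" by auto
    finally show ?thesis by (simp add: sum.distrib)
  qed
  also have "\<dots> \<le> (\<Sum>j\<in>E `` S'. \<bar>e j\<bar>) + 2 * \<theta> * real d * \<bar>x i\<bar>"
    using clash by (intro add_left_mono mult_right_mono) auto
  finally have e': "C * (\<Sum>j\<in>E `` S'. \<bar>e' j\<bar>)
      \<le> C * (\<Sum>j\<in>E `` S'. \<bar>e j\<bar>) + C * (2 * \<theta> * real d * \<bar>x i\<bar>)"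
    using C0 by (simp flip: distrib_left)
  have Cd: "C * (2 * \<theta> * real d * \<bar>x i\<bar>) = 4 * \<theta> / (1 - 4 * \<theta>) * \<bar>x i\<bar>"
    using d by (simp add: C_def)

  have IH: "(\<Sum>l\<in>S'. err S' e' l)
      \<le> 4 * \<theta> / (1 - 4 * \<theta>) * (\<Sum>l\<in>S'. \<bar>x l\<bar>) + C * (\<Sum>j\<in>E `` S'. \<bar>e' j\<bar>)"
    unfolding err_def C_def
    using Suc.hyps(2) S_eq fS' deg exp by (intro Suc.hyps(1)) auto
  have "(\<Sum>l\<in>S. err S e l) = err S e i + (\<Sum>l\<in>S'. err S' e' l)"
    using S_eq(2,3) by (subst S_eq(1)) (simp add: rest)
  also have "\<dots> \<le> 4 * \<theta> / (1 - 4 * \<theta>) * (\<bar>x i\<bar> + (\<Sum>l\<in>S'. \<bar>x l\<bar>))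
      + C * ((\<Sum>j\<in>U. \<bar>e j\<bar>) + (\<Sum>j\<in>E `` S'. \<bar>e j\<bar>))"
    using removed IH e' unfolding Cd by (simp add: distrib_left)
  also have "\<bar>x i\<bar> + (\<Sum>l\<in>S'. \<bar>x l\<bar>) = (\<Sum>l\<in>S. \<bar>x l\<bar>)"
    using S_eq(2,3) by (subst S_eq(1)) simp
  also have "(\<Sum>j\<in>U. \<bar>e j\<bar>) + (\<Sum>j\<in>E `` S'. \<bar>e j\<bar>) = (\<Sum>j\<in>E `` S. \<bar>e j\<bar>)"
    unfolding \<Gamma>_eq(1) using \<Gamma>_eq(2) fU fS' by (simp add: sum.union_disjoint)
  finally show ?case by (simp add: err_def C_def)
qed

section \<open>One step of the iteration\<close>

text \<open>Outside \<open>T\<close> both competitors vanish and have the same distance to \<open>b\<close>, so \<open>z\<close> is at least as good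
  as \<open>u\<close> also on \<open>T\<close> alone. There the triangle inequality through \<open>b\<close> applies; this way the entries
  of \<open>b\<close> outside \<open>T\<close>, over which the expansion gives no control, never enter.\<close>

lemma best_approximation_on_support:
  fixes b u z :: "nat \<Rightarrow> real"
  assumes fin: "finite I" and T: "T \<subseteq> I"
    and z: "\<And>i. i \<in> I - T \<Longrightarrow> z i = 0" and u: "\<And>i. i \<in> I - T \<Longrightarrow> u i = 0"
    and best: "(\<Sum>i\<in>I. \<bar>b i - z i\<bar>) \<le> (\<Sum>i\<in>I. \<bar>b i - u i\<bar>)"
  shows "(\<Sum>i\<in>I. \<bar>z i - u i\<bar>) \<le> 2 * (\<Sum>i\<in>T. \<bar>b i - u i\<bar>)"
proof -
  have split: "(\<Sum>i\<in>I. g i) = (\<Sum>i\<in>I - T. g i) + (\<Sum>i\<in>T. g i)" for g :: "nat \<Rightarrow> real"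
    using sum.subset_diff[OF T fin] .
  have "(\<Sum>i\<in>T. \<bar>b i - z i\<bar>) \<le> (\<Sum>i\<in>T. \<bar>b i - u i\<bar>)"
    using best z u by (simp add: split)
  moreover have "(\<Sum>i\<in>I. \<bar>z i - u i\<bar>) = (\<Sum>i\<in>T. \<bar>z i - u i\<bar>)"
    using z u by (simp add: split)
  moreover have "(\<Sum>i\<in>T. \<bar>z i - u i\<bar>) \<le> (\<Sum>i\<in>T. \<bar>b i - z i\<bar> + \<bar>b i - u i\<bar>)"
    by (rule sum_mono) auto
  ultimately show ?thesis by (simp add: sum.distrib)
qed

lemma adjacency_mat_mult_index:
  assumes "v \<in> carrier_vec N" "j < m"
  shows "(adjacency_mat N m E *\<^sub>v v) $ j = (\<Sum>l<N. if (l, j) \<in> E then v $ l else 0)"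
  using assms
  by (auto simp: adjacency_mat_def scalar_prod_def lessThan_atLeast0 intro!: sum.cong)

text \<open>The contraction: \<open>w\<close> and \<open>z\<close> are consecutive iterates. Each constant is twice the one in
  \<open>median_error_bound\<close>, the factor coming from \<open>best_approximation_on_support\<close>. The vector
  \<open>restrict_vec x S\<close> is admissible in the projection because it is supported in the sparse set \<open>S\<close>.\<close>

lemma projected_median_step:
  fixes E :: "(nat \<times> nat) set" and x e w z :: "real vec" and \<theta> :: real and N m :: nat
  defines "A \<equiv> adjacency_mat N m E"
  assumes reg: "left_regular_bipartite N m d E" and d: "d > 0" and \<theta>: "\<theta> < 1 / 4"
    and S: "S \<subseteq> {..<N}" "model_sparse_set Mk S"
    and x: "x \<in> carrier_vec N" and e: "e \<in> carrier_vec m" and w: "w \<in> carrier_vec N"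
    and proj: "is_model_projection N Mk (w + Med N E (A *\<^sub>v x + e - A *\<^sub>v w)) z"
    and exp: "\<And>S'. S' \<subseteq> S \<union> supp_vec w \<union> supp_vec z \<Longrightarrow>
      (1 - \<theta>) * real d * real (card S') \<le> real (card (E `` S'))"
  shows "l1_norm (z - restrict_vec x S)
    \<le> 8 * \<theta> / (1 - 4 * \<theta>) * l1_norm (w - restrict_vec x S)
      + 4 / ((1 - 4 * \<theta>) * real d) * l1_norm (A *\<^sub>v restrict_vec x ({..<N} - S) + e)"
proof -
  define T where "T = S \<union> supp_vec w \<union> supp_vec z"
  define h where "h = (\<lambda>i. restrict_vec x S $ i - w $ i)"
  define g where "g = A *\<^sub>v restrict_vec x ({..<N} - S) + e"
  define b where "b = w + Med N E (A *\<^sub>v x + e - A *\<^sub>v w)"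
  have z: "z \<in> carrier_vec N"
    using proj by (simp add: is_model_projection_def is_arg_min_linorder)
  have best: "l1_norm (b - z) \<le> l1_norm (b - u)"
    if "u \<in> carrier_vec N" "model_sparse_vec Mk u" for u
    using proj that by (simp add: is_model_projection_def is_arg_min_linorder b_def)
  have dims: "dim_vec x = N" "dim_vec w = N" "dim_vec z = N" "dim_vec e = m" "dim_vec b = N"
    "dim_row A = m" "dim_vec g = m"
    using x w z e by (simp_all add: b_def Med_def A_def adjacency_mat_def g_def)
  have T: "T \<subseteq> {..<N}"
    using S(1) dims by (auto simp: T_def supp_vec_def)
  have finT: "finite T"
    by (rule finite_subset[OF T]) simp
  have E: "E \<subseteq> {..<N} \<times> {..<m}" and deg: "\<And>i. i < N \<Longrightarrow> card (E `` {i}) = d"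
    using reg by (simp_all add: left_regular_bipartite_def)
  have ET: "E `` T \<subseteq> {..<m}"
    using E by blast
  have fE: "finite (E `` T)"
    by (rule finite_subset[OF ET]) simp
  have xS: "restrict_vec x S \<in> carrier_vec N" and xS': "restrict_vec x ({..<N} - S) \<in> carrier_vec N"
    using x by (simp_all add: restrict_vec_def)
  have h0: "h i = 0" if "i \<in> {..<N} - T" for i
    using that dims by (simp add: h_def T_def supp_vec_def restrict_vec_def)

  have residual: "(A *\<^sub>v x + e - A *\<^sub>v w) $ j = (\<Sum>l\<in>T. if (l, j) \<in> E then h l else 0) + g $ j"
    if j: "j < m" for j
  proof -
    have "(\<Sum>l\<in>T. if (l, j) \<in> E then h l else 0) = (\<Sum>l<N. if (l, j) \<in> E then h l else 0)"
      using T h0 finT by (intro sum.mono_neutral_left) auto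
    then have "(\<Sum>l\<in>T. if (l, j) \<in> E then h l else 0) + g $ j
      = (\<Sum>l<N. (if (l, j) \<in> E then h l else 0)
          + (if (l, j) \<in> E then restrict_vec x ({..<N} - S) $ l else 0)) + e $ j"
      using j dims adjacency_mat_mult_index[OF xS' j] by (simp add: g_def A_def sum.distrib)
    also have "(\<Sum>l<N. (if (l, j) \<in> E then h l else 0)
          + (if (l, j) \<in> E then restrict_vec x ({..<N} - S) $ l else 0))
      = (\<Sum>l<N. (if (l, j) \<in> E then x $ l else 0) - (if (l, j) \<in> E then w $ l else 0))"
      using dims by (intro sum.cong) (auto simp: h_def restrict_vec_def)
    also have "\<dots> + e $ j = (A *\<^sub>v x + e - A *\<^sub>v w) $ j"
      using j dims adjacency_mat_mult_index[OF x j] adjacency_mat_mult_index[OF w j]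
      by (simp add: A_def sum_subtractf)
    finally show ?thesis by simp
  qed
  have b_index: "b $ i - restrict_vec x S $ i
      = median (image_mset (\<lambda>j. (\<Sum>l\<in>T. if (l, j) \<in> E then h l else 0) + g $ j)
          (mset_set (E `` {i}))) - h i" if i: "i < N" for i
  proof -
    have "finite (E `` {i})" using deg[OF i] d by (simp add: card_ge_0_finite)
    then have "image_mset (\<lambda>j. (A *\<^sub>v x + e - A *\<^sub>v w) $ j) (mset_set (E `` {i}))
      = image_mset (\<lambda>j. (\<Sum>l\<in>T. if (l, j) \<in> E then h l else 0) + g $ j) (mset_set (E `` {i}))"
      using E by (intro image_mset_cong residual) auto
    then show ?thesis using i dims by (simp add: b_def Med_def h_def)
  qed

  have "model_sparse_vec Mk (restrict_vec x S)"
  proof -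
    have "supp_vec (restrict_vec x S) \<subseteq> S"
      by (auto simp: supp_vec_def restrict_vec_def split: if_splits)
    then show ?thesis
      using S(2) unfolding model_sparse_vec_def model_sparse_set_def by blast
  qed
  then have "l1_norm (b - z) \<le> l1_norm (b - restrict_vec x S)"
    using best xS by blast
  then have "(\<Sum>i<N. \<bar>b $ i - z $ i\<bar>) \<le> (\<Sum>i<N. \<bar>b $ i - restrict_vec x S $ i\<bar>)"
    using dims xS by (simp add: l1_norm_def)
  moreover have "z $ i = 0" "restrict_vec x S $ i = 0" if "i \<in> {..<N} - T" for i
    using that dims by (simp_all add: T_def supp_vec_def restrict_vec_def)
  ultimately have "(\<Sum>i<N. \<bar>z $ i - restrict_vec x S $ i\<bar>)
      \<le> 2 * (\<Sum>i\<in>T. \<bar>b $ i - restrict_vec x S $ i\<bar>)"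
    by (intro best_approximation_on_support T) simp_all
  then have "l1_norm (z - restrict_vec x S) \<le> 2 * (\<Sum>i\<in>T. \<bar>b $ i - restrict_vec x S $ i\<bar>)"
    using dims xS by (simp add: l1_norm_def)
  also have "(\<Sum>i\<in>T. \<bar>b $ i - restrict_vec x S $ i\<bar>)
    = (\<Sum>i\<in>T. \<bar>median (image_mset (\<lambda>j. (\<Sum>l\<in>T. if (l, j) \<in> E then h l else 0) + g $ j)
          (mset_set (E `` {i}))) - h i\<bar>)"
    using T b_index by (intro sum.cong) auto
  also have "\<dots> \<le> 4 * \<theta> / (1 - 4 * \<theta>) * (\<Sum>i\<in>T. \<bar>h i\<bar>)
      + 2 / ((1 - 4 * \<theta>) * real d) * (\<Sum>j\<in>E `` T. \<bar>g $ j\<bar>)"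
  proof (rule median_error_bound[OF finT fE d \<theta>])
    show "card (E `` {i}) = d" if "i \<in> T" for i using that T deg by blast
    show "(1 - \<theta>) * real d * real (card S') \<le> real (card (E `` S'))" if "S' \<subseteq> T" for S'
      using that unfolding T_def by (rule exp)
  qed
  also have "(\<Sum>i\<in>T. \<bar>h i\<bar>) = l1_norm (w - restrict_vec x S)"
  proof -
    have "(\<Sum>i\<in>T. \<bar>h i\<bar>) = (\<Sum>i<N. \<bar>h i\<bar>)"
      using T h0 finT by (intro sum.mono_neutral_left) auto
    then show ?thesis
      using dims by (simp add: l1_norm_def h_def restrict_vec_def abs_minus_commute)
  qed
  also have "2 / ((1 - 4 * \<theta>) * real d) * (\<Sum>j\<in>E `` T. \<bar>g $ j\<bar>)
      \<le> 2 / ((1 - 4 * \<theta>) * real d) * l1_norm g"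
    using ET \<theta> unfolding l1_norm_def dims by (intro mult_left_mono sum_mono2) simp_all
  finally show ?thesis by (simp add: g_def distrib_left mult.assoc)
qed

section \<open>The expansion coefficient\<close>

text \<open>For a nonempty set \<open>S\<close> the expansion inequality is a lower bound
  \<open>1 - |\<Gamma>(S)| / (d |S|)\<close> on \<open>\<epsilon>\<close>. There are finitely many such bounds, and at least one, so the least
  admissible \<open>\<epsilon>\<close> is their maximum.\<close>

lemma expansion_coeff_attained:
  assumes d: "d > 0" and sub: "\<And>S. model_sparse_set Mk S \<Longrightarrow> S \<subseteq> {..<N}"
    and ex: "model_sparse_set Mk S0" "S0 \<noteq> {}"
  shows "model_expander d E Mk (expansion_coeff d E Mk)"
proof -
  define F where "F = {S. model_sparse_set Mk S \<and> S \<noteq> {}}"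
  define \<rho> where "\<rho> = (\<lambda>S. 1 - real (card (E `` S)) / (real d * real (card S)))"
  have "F \<subseteq> Pow {..<N}" using sub by (auto simp: F_def)
  then have F: "finite F" "F \<noteq> {}" "\<And>S. S \<in> F \<Longrightarrow> card S > 0"
    using ex by (auto simp: F_def card_gt_0_iff finite_subset dest: sub intro: finite_subset[of F "Pow {..<N}"])
  have "real (card (E `` S)) \<ge> (1 - \<epsilon>) * real d * real (card S) \<longleftrightarrow> \<rho> S \<le> \<epsilon>" if "S \<in> F" for S \<epsilon>
    using F(3)[OF that] d by (simp add: \<rho>_def field_simps)
  then have "model_expander d E Mk \<epsilon> \<longleftrightarrow> (\<forall>S\<in>F. \<rho> S \<le> \<epsilon>)" for \<epsilon>
    unfolding model_expander_def F_def by fastforce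
  then have iff: "model_expander d E Mk \<epsilon> \<longleftrightarrow> Max (\<rho> ` F) \<le> \<epsilon>" for \<epsilon>
    using F by auto
  have "expansion_coeff d E Mk = Max (\<rho> ` F)"
    unfolding expansion_coeff_def iff by (rule Least_equality) auto
  then show ?thesis unfolding iff by simp
qed

lemma model_expander_nonneg:
  assumes "model_expander d E Mk \<epsilon>" "d > 0" "model_sparse_set Mk {i}" "card (E `` {i}) = d"
  shows "\<epsilon> \<ge> 0"
proof -
  have "(1 - \<epsilon>) * real d \<le> 1 * real d"
    using assms(1,3,4) unfolding model_expander_def by force
  then show ?thesis using assms(2) by (simp add: mult_le_cancel_right)
qed

section \<open>Tree and group models\<close>

text \<open>Convergence uses the two kinds of models only through the following facts.\<close>

lemma model_sparse_set_subset:
  "model_sparse_set Mk S \<Longrightarrow> S' \<subseteq> S \<Longrightarrow> model_sparse_set Mk S'"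
  unfolding model_sparse_set_def by blast

lemma model_sparse_set_bounded:
  assumes "is_tree_model N \<M> \<or> is_group_model N \<M>" "model_sparse_set (\<M> k) S"
  shows "S \<subseteq> {..<N}"
  using assms
  unfolding is_tree_model_def is_group_model_def model_sparse_set_def
    rooted_subtrees_def group_unions_def by blast

lemma model_sparse_singleton:
  assumes "is_tree_model N \<M> \<or> is_group_model N \<M>" "k \<ge> 1" "N \<ge> 1"
  obtains i where "i < N" "model_sparse_set (\<M> k) {i}"
  using assms(1)
proof
  assume "is_tree_model N \<M>"
  then obtain D r T where T: "dary_rooted_tree D {..<N} r T" and \<M>: "\<M> = rooted_subtrees {..<N} T"
    unfolding is_tree_model_def by blast
  have "(u, r) \<notin> T\<^sup>+" for u
    using T unfolding dary_rooted_tree_def by (metis tranclE)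
  then have "{r} \<in> \<M> k"
    using T assms(2) by (auto simp: \<M> rooted_subtrees_def dary_rooted_tree_def)
  then show thesis
    using T that unfolding model_sparse_set_def dary_rooted_tree_def by blast
next
  assume "is_group_model N \<M>"
  then obtain \<GG> where \<GG>: "\<Union>\<GG> = {..<N}" and \<M>: "\<M> = group_unions \<GG>"
    unfolding is_group_model_def by blast
  have "0 \<in> \<Union>\<GG>" using \<GG> assms(3) by auto
  then obtain G where "G \<in> \<GG>" "0 \<in> G" by blast
  moreover have "\<Union>{G} \<in> \<M> k"
    unfolding \<M> group_unions_def using \<open>G \<in> \<GG>\<close> assms(2) by (intro CollectI exI[of _ "{G}"]) auto
  ultimately have "model_sparse_set (\<M> k) {0}"
    unfolding model_sparse_set_def by auto
  then show thesis using that[of 0] assms(3) by simp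
qed

lemma model_sparse_set_Un:
  assumes "is_tree_model N \<M> \<or> is_group_model N \<M>"
    and "model_sparse_set (\<M> a) S" "model_sparse_set (\<M> b) S'"
  shows "model_sparse_set (\<M> (a + b)) (S \<union> S')"
proof -
  obtain K K' where K: "K \<in> \<M> a" "S \<subseteq> K" "K' \<in> \<M> b" "S' \<subseteq> K'"
    using assms(2,3) unfolding model_sparse_set_def by blast
  have "K \<union> K' \<in> \<M> (a + b)"
    using assms(1)
  proof
    assume "is_tree_model N \<M>"
    then obtain T where \<M>: "\<M> = rooted_subtrees {..<N} T"
      unfolding is_tree_model_def by blast
    show ?thesis
      using K(1,3) card_Un_le[of K K'] unfolding \<M> rooted_subtrees_def by auto
  next
    assume "is_group_model N \<M>"
    then obtain \<GG> where \<M>: "\<M> = group_unions \<GG>"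
      unfolding is_group_model_def by blast
    obtain \<C> \<C>' where "\<C> \<subseteq> \<GG>" "card \<C> \<le> a" "K = \<Union>\<C>" "\<C>' \<subseteq> \<GG>" "card \<C>' \<le> b" "K' = \<Union>\<C>'"
      using K(1,3) unfolding \<M> group_unions_def by blast
    then show ?thesis
      using card_Un_le[of \<C> \<C>'] unfolding \<M> group_unions_def
      by (intro CollectI exI[of _ "\<C> \<union> \<C>'"]) auto
  qed
  then show ?thesis
    using K(2,4) unfolding model_sparse_set_def by blast
qed

section \<open>Convergence of the iteration\<close>

lemma geometric_recursion_bound:
  fixes a :: "nat \<Rightarrow> real"
  assumes "0 \<le> \<alpha>" "\<alpha> < 1" and step: "\<And>n. a (Suc n) \<le> \<alpha> * a n + (1 - \<alpha>) * c"
  shows "a n \<le> \<alpha> ^ n * a 0 + (1 - \<alpha> ^ n) * c"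
proof (induction n)
  case (Suc n)
  have "a (Suc n) \<le> \<alpha> * (\<alpha> ^ n * a 0 + (1 - \<alpha> ^ n) * c) + (1 - \<alpha>) * c"
    using step[of n] mult_left_mono[OF Suc assms(1)] by linarith
  then show ?case by (simp add: algebra_simps)
qed simp

lemma MEIHT_error_bound:
  fixes E :: "(nat \<times> nat) set" and \<M> :: "nat \<Rightarrow> nat set set" and x e :: "real vec" and \<epsilon> :: real
  assumes \<epsilon>: "0 \<le> \<epsilon>" "\<epsilon> < 1 / 12" and d: "d \<ge> 1" and k: "k \<ge> 1" and N: "N \<ge> 1"
    and model: "is_tree_model N \<M> \<or> is_group_model N \<M>"
    and reg: "left_regular_bipartite N m d E"
    and exp: "model_expander d E (\<M> (3 * k)) \<epsilon>"
    and S: "model_sparse_set (\<M> k) S"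
    and x: "x \<in> carrier_vec N" and e: "e \<in> carrier_vec m"
    and xs: "MEIHT_sequence N m E (\<M> k) (adjacency_mat N m E *\<^sub>v x + e) xs"
  defines "\<alpha> \<equiv> 8 * \<epsilon> / (1 - 4 * \<epsilon>)"
  defines "\<beta> \<equiv> 4 / (1 - 12 * \<epsilon>)"
  shows "l1_norm (xs n - restrict_vec x S) \<le> \<alpha> ^ n * l1_norm (xs 0 - restrict_vec x S)
    + (1 - \<alpha> ^ n) * \<beta> * l1_norm (adjacency_mat N m E *\<^sub>v restrict_vec x ({..<N} - S) + e)"
proof -
  define A where "A = adjacency_mat N m E"
  define g where "g = l1_norm (A *\<^sub>v restrict_vec x ({..<N} - S) + e)"
  have g0: "0 \<le> g" by (simp add: g_def l1_norm_def sum_nonneg)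
  have \<alpha>: "0 \<le> \<alpha>" "\<alpha> < 1" using \<epsilon> by (auto simp: \<alpha>_def field_simps)
  have \<beta>: "(1 - \<alpha>) * \<beta> = 4 / (1 - 4 * \<epsilon>)"
    using \<epsilon> by (simp add: \<alpha>_def \<beta>_def divide_simps)
  have proj: "is_model_projection N (\<M> k)
      (xs n + Med N E (A *\<^sub>v x + e - A *\<^sub>v xs n)) (xs (Suc n))" for n
    using xs by (simp add: MEIHT_sequence_def A_def)
  have sparse: "xs n \<in> carrier_vec N \<and> model_sparse_set (\<M> k) (supp_vec (xs n))" for n
  proof (cases n)
    case 0
    obtain i where "model_sparse_set (\<M> k) {i}"
      using model_sparse_singleton[OF model k N] by blast
    then have "model_sparse_set (\<M> k) {}" by (rule model_sparse_set_subset) simp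
    moreover have "xs 0 = 0\<^sub>v N" using xs by (simp add: MEIHT_sequence_def)
    moreover have "supp_vec (0\<^sub>v N) = {}" by (auto simp: supp_vec_def)
    ultimately show ?thesis using 0 by simp
  next
    case (Suc n')
    then show ?thesis
      using proj[of n']
      by (simp add: is_model_projection_def is_arg_min_def model_sparse_vec_def)
  qed
  have step: "l1_norm (xs (Suc n) - restrict_vec x S)
      \<le> \<alpha> * l1_norm (xs n - restrict_vec x S) + (1 - \<alpha>) * (\<beta> * g)" for n
  proof -
    have "model_sparse_set (\<M> (k + k + k)) (S \<union> supp_vec (xs n) \<union> supp_vec (xs (Suc n)))"
      using S sparse by (intro model_sparse_set_Un[OF model]) auto
    moreover have "k + k + k = 3 * k" by simp
    ultimately have "(1 - \<epsilon>) * real d * real (card S') \<le> real (card (E `` S'))"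
      if "S' \<subseteq> S \<union> supp_vec (xs n) \<union> supp_vec (xs (Suc n))" for S'
      using exp model_sparse_set_subset[OF _ that] unfolding model_expander_def by metis
    then have "l1_norm (xs (Suc n) - restrict_vec x S)
      \<le> \<alpha> * l1_norm (xs n - restrict_vec x S) + 4 / ((1 - 4 * \<epsilon>) * real d) * g"
      unfolding \<alpha>_def g_def A_def
      using d \<epsilon> S x e sparse proj model_sparse_set_bounded[OF model S]
      by (intro projected_median_step[OF reg]) (auto simp: A_def)
    also have "4 / ((1 - 4 * \<epsilon>) * real d) * g \<le> 4 / (1 - 4 * \<epsilon>) * g"
    proof (rule mult_right_mono[OF _ g0])
      have "(1 - 4 * \<epsilon>) * 1 \<le> (1 - 4 * \<epsilon>) * real d"
        using \<epsilon> d by (intro mult_left_mono) auto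
      then show "4 / ((1 - 4 * \<epsilon>) * real d) \<le> 4 / (1 - 4 * \<epsilon>)"
        using \<epsilon> by (intro divide_left_mono) auto
    qed
    finally show ?thesis by (simp flip: \<beta> add: mult.assoc)
  qed
  show ?thesis
    using geometric_recursion_bound[of \<alpha> "\<lambda>n. l1_norm (xs n - restrict_vec x S)" "\<beta> * g" n, OF \<alpha> step]
    by (simp add: g_def A_def mult.assoc)
qed

theorem theorem3p3:
  fixes \<epsilon> :: real
  assumes "\<epsilon> < 1 / 12"
  shows "\<exists>\<alpha> \<beta> :: real. \<alpha> < 1 \<and> \<beta> > 0 \<and>
    (\<forall>(N::nat) (m::nat) (d::nat) (k::nat) (E :: (nat \<times> nat) set) (\<M> :: nat \<Rightarrow> nat set set) (A :: real mat).
       N \<ge> 1 \<longrightarrow> d \<ge> 1 \<longrightarrow> k \<ge> 1 \<longrightarrow>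
       is_tree_model N \<M> \<or> is_group_model N \<M> \<longrightarrow>
       left_regular_bipartite N m d E \<longrightarrow>
       A = adjacency_mat N m E \<longrightarrow>
       expansion_coeff d E (\<M> (3 * k)) = \<epsilon> \<longrightarrow>
       (\<forall>(S :: nat set) (x :: real vec) (e :: real vec) (xs :: nat \<Rightarrow> real vec).
          model_sparse_set (\<M> k) S \<longrightarrow>
          x \<in> carrier_vec N \<longrightarrow>
          e \<in> carrier_vec m \<longrightarrow>
          MEIHT_sequence N m E (\<M> k) (A *\<^sub>v x + e) xs \<longrightarrow>
          (\<forall>n. l1_norm (xs n - restrict_vec x S)
             \<le> \<alpha> ^ n * l1_norm (xs 0 - restrict_vec x S)
               + (1 - \<alpha> ^ n) * \<beta> * l1_norm (A *\<^sub>v restrict_vec x ({..<N} - S) + e))))"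
proof (intro exI conjI allI impI)
  \<comment> \<open>The rate has to be fixed before a graph is given, while \<open>0 \<le> \<epsilon>\<close> follows only from a graph
    with coefficient \<open>\<epsilon>\<close>. The maximum covers negative values of \<open>\<epsilon>\<close>, which no graph attains.\<close>
  show "max 0 (8 * \<epsilon> / (1 - 4 * \<epsilon>)) < 1" and "4 / (1 - 12 * \<epsilon>) > 0"
    using assms by (auto simp: field_simps)
next
  fix N m d k :: nat and E :: "(nat \<times> nat) set" and \<M> :: "nat \<Rightarrow> nat set set" and A :: "real mat"
    and S :: "nat set" and x e :: "real vec" and xs :: "nat \<Rightarrow> real vec" and n :: nat
  assume N: "N \<ge> 1" and d: "d \<ge> 1" and k: "k \<ge> 1"
    and model: "is_tree_model N \<M> \<or> is_group_model N \<M>"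
    and reg: "left_regular_bipartite N m d E"
    and A: "A = adjacency_mat N m E"
    and coeff: "expansion_coeff d E (\<M> (3 * k)) = \<epsilon>"
    and S: "model_sparse_set (\<M> k) S"
    and x: "x \<in> carrier_vec N" and e: "e \<in> carrier_vec m"
    and xs: "MEIHT_sequence N m E (\<M> k) (A *\<^sub>v x + e) xs"
  obtain i where i: "i < N" "model_sparse_set (\<M> (3 * k)) {i}"
    using model_sparse_singleton[OF model _ N, of "3 * k"] k by auto
  have exp: "model_expander d E (\<M> (3 * k)) \<epsilon>"
    using expansion_coeff_attained[of d "\<M> (3 * k)" N "{i}" E] d i(2) coeff
      model_sparse_set_bounded[OF model] by auto
  moreover have "card (E `` {i}) = d"
    using reg i(1) by (simp add: left_regular_bipartite_def)
  ultimately have \<epsilon>: "0 \<le> \<epsilon>"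
    using model_expander_nonneg d i(2) by fastforce
  then have "max 0 (8 * \<epsilon> / (1 - 4 * \<epsilon>)) = 8 * \<epsilon> / (1 - 4 * \<epsilon>)"
    using assms by simp
  then show "l1_norm (xs n - restrict_vec x S)
      \<le> max 0 (8 * \<epsilon> / (1 - 4 * \<epsilon>)) ^ n * l1_norm (xs 0 - restrict_vec x S)
        + (1 - max 0 (8 * \<epsilon> / (1 - 4 * \<epsilon>)) ^ n) * (4 / (1 - 12 * \<epsilon>))
          * l1_norm (A *\<^sub>v restrict_vec x ({..<N} - S) + e)"
    using MEIHT_error_bound[OF \<epsilon> assms d k N model reg exp S x e, of xs n] xs A by simp
qed

end
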